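(* Let $p$ be a prime number, and let $n,m,B$ be positive integers with $1\le m\le n-1$, $n>2$ and $\gcd(n,mB)=1$. Then $f(X)=X^n+p(BX+1)^m$ is monogenic if and only if $n^n+(-1)^{n+m}B^n(n-m)^{n-m}m^mp$ is square-free.
   Context: A monic irreducible polynomial $f\in\mathbb{Z}[X]$ with root $\theta$ is called monogenic if $\mathbb{Z}[\theta]=\mathcal{O}_K$, where $\mathcal{O}_K$ is the ring of integers of $K=\mathbb{Q}(\theta)$. (The polynomial $f$ here is Eisenstein at $p$, hence irreducible.) An integer is square-free if it is not divisible by $q^2$ for any prime $q$. *)

theory Defs
  imports
    "HOL-Algebra.Generated_Fields"
    "HOL-Algebra.Algebraic_Closure_Type"
    "HOL-Computational_Algebra.Computational_Algebra"
begin

text \<open>All number fields are taken inside the complex numbers, viewed as a field in the sense of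
  HOL-Algebra via \<^const>\<open>ring_of_type_algebra\<close>.\<close>

definition adjoin_int :: "complex \<Rightarrow> complex set" where
  "adjoin_int \<theta> = generate_ring ring_of_type_algebra {\<theta>}"

text \<open>A subfield of the complex numbers contains the rationals, so the subfield generated by
  \<open>\<theta>\<close> alone is \<open>\<rat>(\<theta>)\<close>.\<close>

definition adjoin_rat :: "complex \<Rightarrow> complex set" where
  "adjoin_rat \<theta> = generate_field ring_of_type_algebra {\<theta>}"

definition ring_of_integers :: "complex set \<Rightarrow> complex set" where
  "ring_of_integers K = {x \<in> K. algebraic_int x}"

text \<open>The roots of an irreducible polynomial are conjugate, so asking for
  \<open>\<int>[\<theta>] = \<O>\<^sub>K\<close> at every complex root is the same as asking for it at one of them.
  Irreducibility is meant in \<open>\<int>[X]\<close>; for monic polynomials it agrees with irreducibility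
  over the rationals.\<close>

definition monogenic :: "int poly \<Rightarrow> bool" where
  "monogenic f \<longleftrightarrow> lead_coeff f = 1 \<and> Factorial_Ring.irreducible f \<and>
     (\<forall>\<theta>. poly (map_poly of_int f) \<theta> = 0 \<longrightarrow> adjoin_int \<theta> = ring_of_integers (adjoin_rat \<theta>))"

end

theory Submission
  imports Defs "HOL-Number_Theory.Cong" "Jordan_Normal_Form.Char_Poly"
begin

text \<open>
  Let \<open>d = (n - m) B\<close>, let \<open>L = d X + n\<close> and let \<open>D\<close> be the integer of the statement. From
  \<open>X f' - n f = - p (B X + 1)\<^sup>m\<^sup>-\<^sup>1 L\<close>, a multiple root of \<open>f\<close> modulo a prime \<open>q \<noteq> p\<close> is a root
  \<open>a\<close> of \<open>L\<close>, and if \<open>d a \<equiv> - n\<close> modulo \<open>q\<^sup>2\<close> then \<open>d\<^sup>n f(a) \<equiv> (-1)\<^sup>n D\<close> modulo \<open>q\<^sup>2\<close>.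

  If \<open>\<int>[\<theta>]\<close> is not maximal at \<open>q\<close>, let \<open>g\<close> generate modulo \<open>q\<close> the ideal of all \<open>h\<close> with \<open>h(\<theta>)/q\<close>
  integral, and write \<open>f \<equiv> g u\<close>. Integrality of \<open>g(\<theta>)/q\<close> makes \<open>g\<close> nilpotent modulo \<open>(q, u)\<close>,
  hence also \<open>X f' - n f\<close>, and finally \<open>L\<close> because \<open>B X + 1\<close> is a unit modulo \<open>(q, f)\<close>. So \<open>u\<close>
  vanishes at \<open>a\<close>, the quotient \<open>y = (f(\<theta>) - f(a)) / (q (\<theta> - a))\<close> is integral, and this forces
  \<open>q\<^sup>2 | f(a)\<close>, so \<open>q\<^sup>2 | D\<close>. At \<open>q = p\<close> the same argument with \<open>a = 0\<close> contradicts \<open>f(0) = p\<close>.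

  Conversely, if \<open>q\<^sup>2 | D\<close> then \<open>q\<close> is prime to \<open>n\<close> and \<open>d\<close>, so \<open>q\<^sup>2 | f(a)\<close> and \<open>q | f'(a)\<close>, and
  with \<open>f = (X - a)\<^sup>2 g + f'(a) (X - a) + f(a)\<close> the element \<open>(\<theta> - a) g(\<theta>)/q\<close> is integral but not
  in \<open>\<int>[\<theta>]\<close>.
\<close>

subsection \<open>Algebraic integers\<close>

definition int_eval :: "complex \<Rightarrow> int poly \<Rightarrow> complex" where
  "int_eval x h = poly (map_poly of_int h) x"

lemma int_eval_simps [simp]:
  "int_eval x 0 = 0" "int_eval x 1 = 1"
  "int_eval x (pCons c h) = of_int c + x * int_eval x h"
  "int_eval x (g + h) = int_eval x g + int_eval x h"
  "int_eval x (g - h) = int_eval x g - int_eval x h"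
  "int_eval x (- h) = - int_eval x h"
  "int_eval x (g * h) = int_eval x g * int_eval x h"
  "int_eval x (h ^ k) = int_eval x h ^ k"
  "int_eval x (smult c h) = of_int c * int_eval x h"
  by (simp_all add: int_eval_def hom_distribs)

lemma int_eval_sum [simp]: "int_eval x (sum g A) = (\<Sum>i\<in>A. int_eval x (g i))"
  by (induction A rule: infinite_finite_induct) auto

lemma int_eval_altdef: "int_eval x h = (\<Sum>i\<le>degree h. of_int (coeff h i) * x ^ i)"
  by (simp add: int_eval_def poly_altdef)

lemma algebraic_int_iff_int_eval:
  "algebraic_int x \<longleftrightarrow> (\<exists>P. int_eval x P = 0 \<and> lead_coeff P = 1)"
  by (simp add: algebraic_int_altdef_ipoly int_eval_def)

interpretation int_mod: Modules.module "\<lambda>(k::int) (x::complex). of_int k * x"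
  by unfold_locales (auto simp: algebra_simps)

text \<open>As a rewrite rule it loops together with \<open>of_int_mult\<close>.\<close>

declare int_mod.scale_scale [simp del]

lemma algebraic_int_if_eigenvalue:
  fixes v :: "nat \<Rightarrow> complex"
  assumes eq: "\<And>i. i < N \<Longrightarrow> y * v i = (\<Sum>j<N. of_int (A i j) * v j)"
    and "i0 < N" "v i0 \<noteq> 0"
  shows "algebraic_int y"
proof -
  define M where "M = mat N N (\<lambda>(i, j). A i j)"
  define M' :: "complex mat" where "M' = map_mat of_int M"
  define w where "w = vec N v"
  have M: "M \<in> carrier_mat N N" and M': "M' \<in> carrier_mat N N"
    by (auto simp: M_def M'_def)
  have "eigenvector M' w y"
    unfolding eigenvector_def
  proof (intro conjI)
    show "w \<in> carrier_vec (dim_row M')" using M' by (auto simp: w_def)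
    have "w $ i0 \<noteq> 0" using assms by (simp add: w_def)
    then show "w \<noteq> 0\<^sub>v (dim_row M')" using M' assms(2) by auto
    show "M' *\<^sub>v w = y \<cdot>\<^sub>v w"
      using M' by (intro eq_vecI)
        (auto simp: w_def eq M'_def M_def scalar_prod_def atLeast0LessThan intro!: sum.cong)
  qed
  then have "poly (char_poly M') y = 0"
    using eigenvalue_root_char_poly[OF M'] unfolding eigenvalue_def by blast
  then have "int_eval y (char_poly M) = 0"
    using of_int_hom.char_poly_hom[OF M, where ?'a = complex] by (simp add: M'_def int_eval_def)
  moreover have "lead_coeff (char_poly M) = 1"
    using degree_monic_char_poly[OF M] by auto
  ultimately show ?thesis unfolding algebraic_int_iff_int_eval by blast
qed

lemma algebraic_int_if_stable_span:
  assumes "finite V" "w \<in> V" "w \<noteq> 0"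
    and st: "\<And>v. v \<in> V \<Longrightarrow> y * v \<in> int_mod.span V"
  shows "algebraic_int y"
proof -
  obtain e where e: "bij_betw e {..<card V} V"
    using ex_bij_betw_nat_finite[OF \<open>finite V\<close>] by (auto simp: atLeast0LessThan)
  have "\<forall>v\<in>V. \<exists>c. y * v = (\<Sum>u\<in>V. of_int (c u) * u)"
    using st int_mod.span_finite[OF \<open>finite V\<close>] by auto
  then obtain c where c: "\<And>v. v \<in> V \<Longrightarrow> y * v = (\<Sum>u\<in>V. of_int (c v u) * u)"
    by metis
  obtain i0 where i0: "i0 < card V" "e i0 = w"
    using e \<open>w \<in> V\<close> by (metis bij_betw_iff_bijections lessThan_iff)
  show ?thesis
  proof (rule algebraic_int_if_eigenvalue[where v = e and ?i0.0 = i0])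
    fix i assume "i < card V"
    then have "e i \<in> V" using e by (auto simp: bij_betw_def)
    then show "y * e i = (\<Sum>j<card V. of_int (c (e i) (e j)) * e j)"
      unfolding c[OF \<open>e i \<in> V\<close>] using sum.reindex_bij_betw[OF e, of "\<lambda>u. of_int (c (e i) u) * u"] by simp
  qed (use i0 \<open>w \<noteq> 0\<close> in auto)
qed

lemma mult_in_int_span:
  assumes "\<And>v. v \<in> V \<Longrightarrow> y * v \<in> int_mod.span V" and "z \<in> int_mod.span V"
  shows "y * z \<in> int_mod.span V"
  using assms(2)
proof (induction rule: int_mod.span_induct_alt)
  case base
  then show ?case by (simp add: int_mod.span_zero)
next
  case (step c u z)
  have "y * (of_int c * u + z) = of_int c * (y * u) + y * z" by (simp add: algebra_simps)
  then show ?case using step assms(1) by (metis int_mod.span_add int_mod.span_scale)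
qed

lemma algebraic_int_tower:
  assumes x: "algebraic_int x" and "0 < k"
    and y: "y ^ k = (\<Sum>j<k. int_eval x (g j) * y ^ j)"
  shows "algebraic_int y" "algebraic_int (x + y)" "algebraic_int (x * y)"
proof -
  obtain P where P: "int_eval x P = 0" "lead_coeff P = 1"
    using x unfolding algebraic_int_iff_int_eval by blast
  define a where "a = degree P"
  have a: "0 < a"
  proof (rule ccontr)
    assume "\<not> 0 < a"
    then obtain c where "P = [:c:]" by (auto simp: a_def elim: degree_eq_zeroE)
    then show False using P by simp
  qed
  have xa: "x ^ a = (\<Sum>i<a. of_int (- coeff P i) * x ^ i)"
    using P unfolding int_eval_altdef a_def[symmetric]
    by (simp add: lessThan_Suc_atMost[symmetric] a_def sum_negf add_eq_0_iff)
  define V where "V = (\<lambda>(i, j). x ^ i * y ^ j) ` ({..<a} \<times> {..<k})"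
  have mem: "x ^ i * y ^ j \<in> V" if "i < a" "j < k" for i j
    using that unfolding V_def by force
  have V: "finite V" "1 \<in> V" using mem[of 0 0] a \<open>0 < k\<close> by (auto simp: V_def)
  define R where "R = {z. \<forall>v\<in>V. z * v \<in> int_mod.span V}"
  have span: "z * v \<in> int_mod.span V" if "z \<in> R" "v \<in> int_mod.span V" for z v
    using that mult_in_int_span[of V z v] by (simp add: R_def)
  have R_mult: "z * z' \<in> R" if "z \<in> R" "z' \<in> R" for z z'
  proof -
    have "z * z' * v \<in> int_mod.span V" if "v \<in> V" for v
      using span[OF \<open>z \<in> R\<close>, of "z' * v"] \<open>z' \<in> R\<close> that by (simp add: R_def mult.assoc)
    then show ?thesis by (simp add: R_def)
  qed
  have R_add: "z + z' \<in> R" if "z \<in> R" "z' \<in> R" for z z'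
    using that unfolding R_def by (auto simp: distrib_right int_mod.span_add)
  have R_int: "of_int c \<in> R" for c
    unfolding R_def by (auto intro: int_mod.span_scale int_mod.span_base)
  have R_alg: "algebraic_int z" if "z \<in> R" for z
    using that V by (intro algebraic_int_if_stable_span[of V 1]) (auto simp: R_def)
  have xR: "x \<in> R"
    unfolding R_def
  proof safe
    fix v assume "v \<in> V"
    then obtain i j where ij: "v = x ^ i * y ^ j" "i < a" "j < k" by (auto simp: V_def)
    show "x * v \<in> int_mod.span V"
    proof (cases "Suc i < a")
      case True
      then show ?thesis using mem[of "Suc i" j] ij by (auto simp: mult.assoc intro: int_mod.span_base)
    next
      case False
      then have "Suc i = a" using ij by auto
      then have "x * v = x ^ a * y ^ j" by (auto simp: ij)
      also have "\<dots> = (\<Sum>i<a. of_int (- coeff P i) * (x ^ i * y ^ j))"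
        unfolding xa by (simp add: sum_distrib_right mult.assoc)
      also have "\<dots> \<in> int_mod.span V"
        by (intro int_mod.span_sum int_mod.span_scale int_mod.span_base mem) (use ij in auto)
      finally show ?thesis .
    qed
  qed
  have evR: "int_eval x h \<in> R" for h
    by (induction h) (use R_int[of 0] in \<open>auto intro!: R_add R_mult R_int xR\<close>)
  have yR: "y \<in> R"
    unfolding R_def
  proof safe
    fix v assume "v \<in> V"
    then obtain i j where ij: "v = x ^ i * y ^ j" "i < a" "j < k" by (auto simp: V_def)
    show "y * v \<in> int_mod.span V"
    proof (cases "Suc j < k")
      case True
      then show ?thesis using mem[of i "Suc j"] ij
        by (auto simp: mult.left_commute intro: int_mod.span_base)
    next
      case False
      then have "Suc j = k" using ij by auto
      then have "y * v = x ^ i * y ^ k" by (auto simp: ij)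
      also have "\<dots> = (\<Sum>j<k. int_eval x (g j) * (x ^ i * y ^ j))"
        unfolding y by (simp add: sum_distrib_left mult_ac)
      also have "\<dots> \<in> int_mod.span V"
        by (intro int_mod.span_sum span evR int_mod.span_base mem) (use ij in auto)
      finally show ?thesis .
    qed
  qed
  show "algebraic_int y" "algebraic_int (x + y)" "algebraic_int (x * y)"
    by (intro R_alg R_add R_mult xR yR)+
qed

lemma algebraic_int_add_mult:
  fixes x y :: complex
  assumes "algebraic_int x" "algebraic_int y"
  shows "algebraic_int (x + y)" "algebraic_int (x * y)"
proof -
  obtain P where P: "int_eval y P = 0" "lead_coeff P = 1"
    using assms(2) unfolding algebraic_int_iff_int_eval by blast
  define k where "k = degree P"
  have k: "0 < k"
  proof (rule ccontr)
    assume "\<not> 0 < k"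
    then obtain c where "P = [:c:]" by (auto simp: k_def elim: degree_eq_zeroE)
    then show False using P by simp
  qed
  have "y ^ k = (\<Sum>i<k. int_eval x [:- coeff P i:] * y ^ i)"
    using P unfolding int_eval_altdef[of y] k_def[symmetric]
    by (simp add: lessThan_Suc_atMost[symmetric] k_def sum_negf add_eq_0_iff)
  from algebraic_int_tower(2,3)[OF assms(1) k this]
  show "algebraic_int (x + y)" "algebraic_int (x * y)" .
qed

lemma algebraic_int_int_eval: "algebraic_int x \<Longrightarrow> algebraic_int (int_eval x h)"
  by (induction h) (auto intro: algebraic_int_add_mult int_imp_algebraic_int)

subsection \<open>The ideals \<open>(q, u)\<close> of \<open>\<int>[X]\<close>\<close>

lemma monic_division:
  fixes f g :: "int poly"
  assumes "lead_coeff g = 1"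
  obtains w r where "f = g * w + r" "r = 0 \<or> degree r < degree g"
proof -
  have g: "g \<noteq> 0" using assms by auto
  obtain w r where wr: "pseudo_divmod f g = (w, r)" by force
  show thesis using that pseudo_divmod[OF g wr] assms by auto
qed

definition mod_ideal :: "int \<Rightarrow> int poly \<Rightarrow> int poly set" where
  "mod_ideal q u = {h. \<exists>s. [:q:] dvd h - u * s}"

lemma mod_ideal_dvdI: "[:q:] dvd h \<Longrightarrow> h \<in> mod_ideal q u"
  unfolding mod_ideal_def by (auto intro!: exI[of _ 0])

lemma mod_ideal_genI: "u * s \<in> mod_ideal q u"
  unfolding mod_ideal_def by (auto intro!: exI[of _ s])

lemma mod_ideal_diff: "h \<in> mod_ideal q u \<Longrightarrow> h' \<in> mod_ideal q u \<Longrightarrow> h - h' \<in> mod_ideal q u"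
proof -
  assume "h \<in> mod_ideal q u" "h' \<in> mod_ideal q u"
  then obtain s s' where "[:q:] dvd h - u * s" "[:q:] dvd h' - u * s'" by (auto simp: mod_ideal_def)
  then have "[:q:] dvd (h - h') - u * (s - s')"
    using dvd_diff[of "[:q:]" "h - u * s" "h' - u * s'"] by (simp add: algebra_simps)
  then show ?thesis unfolding mod_ideal_def by blast
qed

lemma mod_ideal_uminus: "h \<in> mod_ideal q u \<Longrightarrow> - h \<in> mod_ideal q u"
  using mod_ideal_diff[of 0 q u h] by (simp add: mod_ideal_dvdI)

lemma mod_ideal_add: "h \<in> mod_ideal q u \<Longrightarrow> h' \<in> mod_ideal q u \<Longrightarrow> h + h' \<in> mod_ideal q u"
  using mod_ideal_diff[of h q u "- h'"] mod_ideal_uminus[of h'] by simp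

lemma mod_ideal_mult: "h \<in> mod_ideal q u \<Longrightarrow> g * h \<in> mod_ideal q u"
proof -
  assume "h \<in> mod_ideal q u"
  then obtain s where "[:q:] dvd h - u * s" by (auto simp: mod_ideal_def)
  then have "[:q:] dvd g * h - u * (g * s)"
    using dvd_mult[of "[:q:]" "h - u * s" g] by (simp add: algebra_simps)
  then show ?thesis unfolding mod_ideal_def by blast
qed

lemma mod_ideal_mult_right: "h \<in> mod_ideal q u \<Longrightarrow> h * g \<in> mod_ideal q u"
  using mod_ideal_mult[of h q u g] by (simp add: mult.commute)

lemma mod_ideal_power_cong:
  assumes "g ^ k \<in> mod_ideal q u" "g - h \<in> mod_ideal q u"
  shows "h ^ k \<in> mod_ideal q u"
proof -
  have "g - h dvd g ^ k - h ^ k" by (simp add: power_diff_sumr2)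
  then obtain t where "g ^ k - h ^ k = (g - h) * t" by (elim dvdE)
  then have "h ^ k = g ^ k - (g - h) * t" by simp
  then show ?thesis using assms mod_ideal_diff mod_ideal_mult_right by metis
qed

lemma mod_ideal_cancel_const:
  assumes "prime q" "\<not> q dvd c" "[:c:] * h \<in> mod_ideal q u"
  shows "h \<in> mod_ideal q u"
proof -
  have "coprime c q" using assms(1,2) prime_imp_coprime coprime_commute by blast
  then obtain s t where st: "s * c + t * q = 1" by (metis bezout_int coprime_imp_gcd_eq_1)
  have "h = [:s * c + t * q:] * h" by (simp add: st one_pCons[symmetric])
  also have "\<dots> = [:s:] * ([:c:] * h) + [:q:] * ([:t:] * h)"
    by (simp add: smult_add_left mult.commute)
  finally have h: "h = [:s:] * ([:c:] * h) + [:q:] * ([:t:] * h)" .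
  show ?thesis
    by (subst h) (intro mod_ideal_add mod_ideal_mult[OF assms(3)] mod_ideal_dvdI dvd_triv_left)
qed

lemma not_const_dvd_reduce:
  fixes h :: "int poly"
  assumes "\<not> [:q:] dvd h"
  obtains h' where "[:q:] dvd h - h'" "degree h' \<le> degree h" "\<not> q dvd lead_coeff h'"
proof
  define h' where "h' = map_poly (\<lambda>c. c mod q) h"
  have c: "coeff h' i = coeff h i mod q" for i by (simp add: h'_def coeff_map_poly)
  show *: "[:q:] dvd h - h'" by (simp add: const_poly_dvd_iff c mod_eq_dvd_iff[symmetric])
  show "degree h' \<le> degree h" by (simp add: h'_def degree_map_poly_le)
  have "h' \<noteq> 0" using * assms by auto
  then have "lead_coeff h' \<noteq> 0" by simp
  then show "\<not> q dvd lead_coeff h'" by (simp add: c dvd_mod_iff mod_eq_0_iff_dvd)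
qed

lemma mod_ideal_low_degree:
  assumes "lead_coeff u = 1" "h \<in> mod_ideal q u" "degree h < degree u"
  shows "[:q:] dvd h"
proof -
  obtain s where s: "[:q:] dvd h - u * s" using assms by (auto simp: mod_ideal_def)
  show ?thesis
  proof (cases "[:q:] dvd s")
    case True
    then show ?thesis using dvd_add[OF s dvd_mult[OF True, of u]] by simp
  next
    case False
    then obtain s' where s': "[:q:] dvd s - s'" "\<not> q dvd lead_coeff s'"
      by (rule not_const_dvd_reduce)
    have "[:q:] dvd h - u * s'"
      using dvd_add[OF s dvd_mult[OF s'(1), of u]] by (simp add: algebra_simps)
    then have "q dvd coeff (h - u * s') (degree u + degree s')"
      by (simp add: const_poly_dvd_iff)
    moreover have "coeff h (degree u + degree s') = 0"
      using assms(3) by (intro coeff_eq_0) simp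
    moreover have "coeff (u * s') (degree u + degree s') = lead_coeff s'"
      using assms(1) by (simp add: coeff_mult_degree_sum)
    ultimately show ?thesis using s'(2) by simp
  qed
qed

lemma not_const_dvd_make_monic:
  fixes h :: "int poly"
  assumes "prime q" "\<not> [:q:] dvd h"
  obtains g a where "lead_coeff g = 1" "degree g \<le> degree h" "[:q:] dvd g - smult a h"
proof -
  obtain h' where h': "[:q:] dvd h - h'" "degree h' \<le> degree h" "\<not> q dvd lead_coeff h'"
    using assms(2) by (rule not_const_dvd_reduce)
  define d where "d = degree h'"
  have "coprime (coeff h' d) q"
    using h'(3) \<open>prime q\<close> by (simp add: d_def coprime_commute prime_imp_coprime)
  then obtain a b where ab: "a * coeff h' d + b * q = 1"
    by (metis cong_def bezout_int coprime_imp_gcd_eq_1)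
  define g where "g = smult a h' + monom (b * q) d"
  have 1: "coeff g d = 1" using ab by (simp add: g_def)
  have "degree g \<le> d"
    unfolding g_def d_def by (intro degree_add_le degree_smult_le degree_monom_le)
  then have d: "degree g = d" using 1 le_degree[of g d] by auto
  have "[:q:] dvd smult a (h' - h) + monom (b * q) d"
    using h'(1) by (intro dvd_add dvd_smult) (auto simp: const_poly_dvd_iff coeff_monom dvd_diff_commute)
  then have "[:q:] dvd g - smult a h" by (simp add: g_def smult_diff_right algebra_simps)
  then show thesis using that[of g a] 1 d h'(2) by (simp add: d_def)
qed

subsection \<open>The ring \<open>\<int>[\<theta>]\<close> and the field \<open>\<rat>(\<theta>)\<close>\<close>

lemma int_eval_pcompose: "int_eval x (pcompose g h) = int_eval (int_eval x h) g"
  by (induction g) (auto simp: pcompose_pCons)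

lemma ring_of_type_algebra_simps [simp]:
  "carrier ring_of_type_algebra = UNIV"
  "x \<otimes>\<^bsub>ring_of_type_algebra\<^esub> y = x * y" "x \<oplus>\<^bsub>ring_of_type_algebra\<^esub> y = x + y"
  "\<one>\<^bsub>ring_of_type_algebra\<^esub> = 1" "\<zero>\<^bsub>ring_of_type_algebra\<^esub> = 0"
  by (simp_all add: ring_of_type_algebra_def)

lemma a_inv_ring_of_type_algebra [simp]:
  "\<ominus>\<^bsub>ring_of_type_algebra\<^esub> (x :: 'a :: comm_ring_1) = - x"
proof -
  interpret cring "ring_of_type_algebra :: 'a ring" by (rule cring_from_type_algebra)
  show ?thesis by (rule minus_equality) auto
qed

lemma m_inv_ring_of_type_algebra [simp]:
  assumes "(x :: 'a :: Fields.field) \<noteq> 0"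
  shows "inv\<^bsub>ring_of_type_algebra\<^esub> x = inverse x"
proof -
  interpret Ring.field "ring_of_type_algebra :: 'a ring" by (rule field_from_type_algebra)
  show ?thesis by (rule comm_inv_char) (use assms in auto)
qed

lemma of_int_mem_if_additive_subgroup:
  fixes A :: "complex set"
  assumes "1 \<in> A" "\<And>x. x \<in> A \<Longrightarrow> - x \<in> A" "\<And>x y. x \<in> A \<Longrightarrow> y \<in> A \<Longrightarrow> x + y \<in> A"
  shows "of_int c \<in> A"
proof -
  have "0 \<in> A" using assms(3)[OF assms(1) assms(2)[OF assms(1)]] by simp
  then have "of_nat m \<in> A" for m by (induction m) (use assms in auto)
  then show ?thesis
    using assms(2) by (cases c rule: int_cases2) auto
qed

lemma int_eval_in_subring:
  assumes "1 \<in> A" "\<And>x. x \<in> A \<Longrightarrow> - x \<in> A" "\<And>x y. x \<in> A \<Longrightarrow> y \<in> A \<Longrightarrow> x + y \<in> A"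
    "\<And>x y. x \<in> A \<Longrightarrow> y \<in> A \<Longrightarrow> x * y \<in> A" "x \<in> A"
  shows "int_eval x h \<in> A"
proof (induction h)
  case 0
  have "of_int 0 \<in> A" by (rule of_int_mem_if_additive_subgroup) (use assms in auto)
  then show ?case by simp
next
  case (pCons c h)
  have "of_int c \<in> A" by (rule of_int_mem_if_additive_subgroup) (use assms in auto)
  moreover have "x * int_eval x h \<in> A"
    by (rule assms(4)[OF \<open>x \<in> A\<close> pCons.IH])
  ultimately have "of_int c + x * int_eval x h \<in> A" by (rule assms(3))
  then show ?case by (simp only: int_eval_simps)
qed

lemma adjoin_int_eq: "adjoin_int \<theta> = range (int_eval \<theta>)"
proof
  show "adjoin_int \<theta> \<subseteq> range (int_eval \<theta>)"
    unfolding adjoin_int_def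
  proof
    fix x assume "x \<in> generate_ring ring_of_type_algebra {\<theta>}"
    then show "x \<in> range (int_eval \<theta>)"
    proof induction
      case one
      show ?case by (rule range_eqI[of _ _ 1]) simp
    next
      case (incl h)
      show ?case by (rule range_eqI[of _ _ "[:0, 1:]"]) (use incl in simp)
    next
      case (a_inv a)
      then obtain g where "a = int_eval \<theta> g" by blast
      then show ?case by (intro range_eqI[of _ _ "- g"]) simp
    next
      case (eng_add a b)
      then obtain g h where "a = int_eval \<theta> g" "b = int_eval \<theta> h" by blast
      then show ?case by (intro range_eqI[of _ _ "g + h"]) simp
    next
      case (eng_mult a b)
      then obtain g h where "a = int_eval \<theta> g" "b = int_eval \<theta> h" by blast
      then show ?case by (intro range_eqI[of _ _ "g * h"]) simp
    qed
  qed
  have "int_eval \<theta> h \<in> adjoin_int \<theta>" for h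
    unfolding adjoin_int_def
    by (rule int_eval_in_subring)
      (use generate_ring.intros[where R = ring_of_type_algebra and H = "{\<theta>}", simplified] in auto)
  then show "range (int_eval \<theta>) \<subseteq> adjoin_int \<theta>" by auto
qed

lemma int_eval_divide_in_adjoin_rat: "int_eval \<theta> h / of_int q \<in> adjoin_rat \<theta>"
proof (cases "q = 0")
  note gf = generate_field.intros[where R = ring_of_type_algebra and H = "{\<theta>}", simplified]
  case True
  have "of_int 0 \<in> adjoin_rat \<theta>"
    unfolding adjoin_rat_def by (rule of_int_mem_if_additive_subgroup) (use gf in auto)
  then show ?thesis using True by simp
next
  note gf = generate_field.intros[where R = ring_of_type_algebra and H = "{\<theta>}", simplified]
  case False
  have "int_eval \<theta> h \<in> adjoin_rat \<theta>"
    unfolding adjoin_rat_def by (rule int_eval_in_subring) (use gf in auto)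
  moreover have "of_int q \<in> adjoin_rat \<theta>"
    unfolding adjoin_rat_def by (rule of_int_mem_if_additive_subgroup) (use gf in auto)
  then have "inverse (of_int q) \<in> adjoin_rat \<theta>"
    using False gf(4)[of "of_int q"] unfolding adjoin_rat_def by simp
  ultimately show ?thesis
    using gf(6) unfolding adjoin_rat_def divide_inverse by blast
qed

lemma int_eval_inverse:
  assumes "algebraic_int \<theta>" "int_eval \<theta> h \<noteq> 0"
  obtains s c where "c \<noteq> 0" "int_eval \<theta> s * int_eval \<theta> h = of_int c"
proof -
  define \<beta> where "\<beta> = int_eval \<theta> h"
  obtain P0 where P0: "int_eval \<beta> P0 = 0" "lead_coeff P0 = 1"
    using algebraic_int_int_eval[OF assms(1)] unfolding \<beta>_def algebraic_int_iff_int_eval by blast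
  have "P0 \<noteq> 0" using P0(2) by auto
  then obtain P where P: "P \<noteq> 0" "int_eval \<beta> P = 0"
    and least: "\<And>P'. P' \<noteq> 0 \<Longrightarrow> int_eval \<beta> P' = 0 \<Longrightarrow> degree P \<le> degree P'"
    using ex_has_least_nat[of "\<lambda>P. P \<noteq> 0 \<and> int_eval \<beta> P = 0" P0 degree] P0(1) by blast
  obtain c Q where cQ: "P = pCons c Q" by (cases P)
  have "c \<noteq> 0"
  proof
    assume "c = 0"
    then have "int_eval \<beta> Q = 0" "Q \<noteq> 0" using P cQ assms by (auto simp: \<beta>_def)
    then show False using least[of Q] cQ by simp
  qed
  moreover have "int_eval \<theta> (pcompose Q h) * \<beta> = of_int (- c)"
    using P cQ by (simp add: int_eval_pcompose \<beta>_def[symmetric] add_eq_0_iff mult.commute)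
  ultimately show thesis using that[of "- c" "pcompose Q h"] by (simp add: \<beta>_def)
qed

lemma adjoin_rat_imp_fraction:
  assumes "algebraic_int \<theta>" "x \<in> adjoin_rat \<theta>"
  shows "\<exists>N h. N \<noteq> 0 \<and> of_int N * x = int_eval \<theta> h"
  using assms(2) unfolding adjoin_rat_def
proof induction
  case one
  show ?case by (rule exI[of _ 1], rule exI[of _ 1]) auto
next
  case (incl h)
  show ?case by (rule exI[of _ 1], rule exI[of _ "[:0, 1:]"]) (use incl in auto)
next
  case (a_inv x)
  then obtain N h where "N \<noteq> 0" "of_int N * x = int_eval \<theta> h" by blast
  then show ?case by (intro exI[of _ N] exI[of _ "-h"]) auto
next
  case (m_inv x)
  then obtain N h where N: "N \<noteq> 0" "of_int N * x = int_eval \<theta> h" by blast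
  then have "int_eval \<theta> h \<noteq> 0" using m_inv by auto
  then obtain s c where c: "c \<noteq> 0" "int_eval \<theta> s * int_eval \<theta> h = of_int c"
    by (rule int_eval_inverse[OF assms(1)])
  have "of_int c * inverse x = of_int N * int_eval \<theta> s"
    using c N m_inv by (simp add: field_simps flip: N(2) c(2))
  then show ?case using c(1) m_inv by (intro exI[of _ c] exI[of _ "smult N s"]) auto
next
  case (eng_add x y)
  then obtain N h M g where *: "N \<noteq> 0" "of_int N * x = int_eval \<theta> h"
    "M \<noteq> 0" "of_int M * y = int_eval \<theta> g" by blast
  have "of_int (N * M) * (x + y) = int_eval \<theta> (smult M h + smult N g)"
    by (simp add: algebra_simps flip: *(2,4))
  then show ?case using * by (metis mult_eq_0_iff ring_of_type_algebra_simps(3))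
next
  case (eng_mult x y)
  then obtain N h M g where *: "N \<noteq> 0" "of_int N * x = int_eval \<theta> h"
    "M \<noteq> 0" "of_int M * y = int_eval \<theta> g" by blast
  have "of_int (N * M) * (x * y) = int_eval \<theta> (h * g)"
    by (simp add: algebra_simps flip: *(2,4))
  then show ?case using * by (metis mult_eq_0_iff ring_of_type_algebra_simps(2))
qed

subsection \<open>Maximality of \<open>\<int>[\<theta>]\<close> at a prime\<close>

lemma synthetic_div_eq:
  fixes f :: "'a :: comm_ring_1 poly"
  shows "f = [:- a, 1:] * synthetic_div f a + [:poly f a:]"
  using synthetic_div_correct'[of a f] by simp

locale monic_irreducible_root =
  fixes f :: "int poly" and \<theta> :: complex
  assumes monic: "lead_coeff f = 1"
    and irreducible: "Factorial_Ring.irreducible f"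
    and root: "int_eval \<theta> f = 0"
begin

lemma algebraic_int_root: "algebraic_int \<theta>"
  using root monic algebraic_int_iff_int_eval by blast

lemma degree_pos: "0 < degree f"
proof (rule ccontr)
  assume "\<not> 0 < degree f"
  then obtain c where "f = [:c:]" by (auto elim: degree_eq_zeroE)
  then show False using monic irreducible by (simp add: one_pCons[symmetric])
qed

lemma degree_le_if_root:
  assumes "h \<noteq> 0" "int_eval \<theta> h = 0"
  shows "degree f \<le> degree h"
proof -
  obtain g where g: "g \<noteq> 0" "int_eval \<theta> g = 0"
    and least: "\<And>g'. g' \<noteq> 0 \<Longrightarrow> int_eval \<theta> g' = 0 \<Longrightarrow> degree g \<le> degree g'"
    using ex_has_least_nat[of "\<lambda>g. g \<noteq> 0 \<and> int_eval \<theta> g = 0" h degree] assms by blast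
  obtain w r where wr: "pseudo_divmod f g = (w, r)" by force
  define c where "c = lead_coeff g ^ (Suc (degree f) - degree g)"
  have c: "c \<noteq> 0" using g(1) by (simp add: c_def)
  have eq: "smult c f = g * w + r" and r: "r = 0 \<or> degree r < degree g"
    using pseudo_divmod[OF g(1) wr] by (auto simp: c_def)
  have "int_eval \<theta> (smult c f) = int_eval \<theta> (g * w + r)" by (simp only: eq)
  then have "int_eval \<theta> r = 0" using g(2) root by simp
  then have "r = 0" using r least[of r] by (metis not_less)
  have "f dvd g * w" using eq \<open>r = 0\<close> by (metis add.right_neutral dvd_smult dvd_refl)
  then have "f dvd g \<or> f dvd w"
    using irreducible prime_elem_dvd_mult_iff irreducible_imp_prime_elem by blast
  then show ?thesis
  proof
    assume "f dvd g"
    then have "degree f \<le> degree g" using g(1) by (rule dvd_imp_degree_le)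
    then show ?thesis using least[OF assms] by simp
  next
    assume "f dvd w"
    then obtain w' where "w = f * w'" by blast
    then have "f * [:c:] = f * (g * w')" using eq \<open>r = 0\<close> by (simp add: mult_ac)
    then have "[:c:] = g * w'" using monic by (metis mult_cancel_left leading_coeff_0_iff zero_neq_one)
    then have "g dvd [:c:]" by simp
    then have "degree g \<le> degree [:c:]" using c by (intro dvd_imp_degree_le) auto
    then have "degree g = 0" by simp
    then obtain d where "g = [:d:]" by (auto elim: degree_eq_zeroE)
    then show ?thesis using g by simp
  qed
qed

lemma reduce:
  obtains h' where "degree h' < degree f" "int_eval \<theta> h' = int_eval \<theta> h" "f dvd h - h'"
proof -
  obtain w r where wr: "h = f * w + r" "r = 0 \<or> degree r < degree f"
    using monic_division[OF monic, of h] by blast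
  show thesis
    by (rule that[of r]) (use wr degree_pos root in auto)
qed

lemma int_eval_eq_0_iff: "int_eval \<theta> h = 0 \<longleftrightarrow> f dvd h"
proof
  assume h: "int_eval \<theta> h = 0"
  obtain r where r: "degree r < degree f" "int_eval \<theta> r = int_eval \<theta> h" "f dvd h - r"
    by (rule reduce)
  have "r = 0" using degree_le_if_root[of r] r h by auto
  then show "f dvd h" using r by simp
qed (auto simp: root)

lemma adjoin_int_subset: "adjoin_int \<theta> \<subseteq> ring_of_integers (adjoin_rat \<theta>)"
  using algebraic_int_int_eval[OF algebraic_int_root] int_eval_divide_in_adjoin_rat[of \<theta> _ 1]
  by (auto simp: adjoin_int_eq ring_of_integers_def)

lemma ring_of_integers_subset:
  assumes "\<And>q x. prime q \<Longrightarrow> algebraic_int x \<Longrightarrow> of_int q * x \<in> adjoin_int \<theta> \<Longrightarrow> x \<in> adjoin_int \<theta>"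
  shows "ring_of_integers (adjoin_rat \<theta>) \<subseteq> adjoin_int \<theta>"
proof
  have *: "\<forall>x. algebraic_int x \<longrightarrow> of_int N * x \<in> adjoin_int \<theta> \<longrightarrow> x \<in> adjoin_int \<theta>" if "N \<noteq> 0" for N
    using that
  proof (induction N rule: prime_divisors_induct)
    case zero
    then show ?case by simp
  next
    case (unit N)
    then have "N = 1 \<or> N = - 1" by auto
    moreover have neg: "x \<in> adjoin_int \<theta>" if x: "- x \<in> adjoin_int \<theta>" for x
    proof -
      obtain h where "- x = int_eval \<theta> h" using x unfolding adjoin_int_eq by blast
      then have "x = int_eval \<theta> (- h)" by (metis int_eval_simps(6) minus_minus)
      then show ?thesis unfolding adjoin_int_eq by blast
    qed
    ultimately show ?case by (elim disjE) simp_all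
  next
    case (factor q N)
    show ?case
    proof (intro allI impI)
      fix x assume x: "algebraic_int x" "of_int (q * N) * x \<in> adjoin_int \<theta>"
      have "algebraic_int (of_int N * x)"
        by (rule algebraic_int_add_mult(2)[OF int_imp_algebraic_int x(1)]) simp
      moreover have "of_int q * (of_int N * x) \<in> adjoin_int \<theta>"
        using x(2) by (simp only: of_int_mult mult.assoc)
      ultimately have "of_int N * x \<in> adjoin_int \<theta>" by (rule assms[OF factor.hyps(1)])
      moreover have "N \<noteq> 0" using factor.prems by simp
      ultimately show "x \<in> adjoin_int \<theta>" using factor.IH x(1) by blast
    qed
  qed
  fix x assume "x \<in> ring_of_integers (adjoin_rat \<theta>)"
  then have x: "x \<in> adjoin_rat \<theta>" "algebraic_int x" by (auto simp: ring_of_integers_def)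
  obtain N h where "N \<noteq> 0" "of_int N * x = int_eval \<theta> h"
    using adjoin_rat_imp_fraction[OF algebraic_int_root x(1)] by blast
  then show "x \<in> adjoin_int \<theta>" using * x(2) by (auto simp: adjoin_int_eq)
qed

lemma power_in_mod_ideal:
  assumes "q \<noteq> 0" and "algebraic_int (int_eval \<theta> g / of_int q)"
  shows "\<exists>k. g ^ k \<in> mod_ideal q f"
proof -
  define y where "y = int_eval \<theta> g / of_int q"
  have y: "int_eval \<theta> g = of_int q * y" using assms by (simp add: y_def)
  obtain P where P: "int_eval y P = 0" "lead_coeff P = 1"
    using assms unfolding y_def algebraic_int_iff_int_eval by blast
  define k where "k = degree P"
  define H where "H = (\<Sum>i<k. smult (coeff P i * q ^ (k - i)) (g ^ i))"
  have "int_eval \<theta> (g ^ k + H) = (\<Sum>i\<le>k. of_int (coeff P i * q ^ (k - i)) * int_eval \<theta> g ^ i)"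
    using P(2) by (simp add: H_def lessThan_Suc_atMost[symmetric] k_def)
  also have "\<dots> = (\<Sum>i\<le>k. of_int q ^ k * (of_int (coeff P i) * y ^ i))"
  proof (rule sum.cong)
    fix i assume "i \<in> {..k}"
    then have "(of_int q :: complex) ^ k = of_int q ^ (k - i) * of_int q ^ i"
      by (simp add: power_add[symmetric])
    then show "of_int (coeff P i * q ^ (k - i)) * int_eval \<theta> g ^ i = of_int q ^ k * (of_int (coeff P i) * y ^ i)"
      by (simp add: y power_mult_distrib)
  qed simp
  also have "\<dots> = of_int q ^ k * int_eval y P"
    unfolding int_eval_altdef[of y] by (simp add: sum_distrib_left k_def)
  finally have "f dvd g ^ k + H" using P(1) by (simp add: int_eval_eq_0_iff[symmetric])
  then obtain w where w: "g ^ k + H = f * w" by blast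
  have "[:q:] dvd H"
    unfolding H_def
  proof (rule dvd_sum)
    fix i assume "i \<in> {..<k}"
    then have "q dvd coeff P i * q ^ (k - i)" by (simp add: dvd_power)
    then show "[:q:] dvd smult (coeff P i * q ^ (k - i)) (g ^ i)"
      by (auto simp: const_poly_dvd_iff)
  qed
  moreover have "g ^ k = f * w - H" using w by (simp add: algebra_simps)
  ultimately have "g ^ k \<in> mod_ideal q f"
    using mod_ideal_genI mod_ideal_dvdI mod_ideal_diff by metis
  then show ?thesis by blast
qed

text \<open>Modulo \<open>q\<close>, the polynomials \<open>h\<close> with \<open>h(\<theta>)/q\<close> integral form an ideal containing \<open>f\<close>;
  \<open>g\<close> is its monic generator.\<close>

lemma non_maximal_factorisation:
  assumes "prime q" "algebraic_int x" "of_int q * x \<in> adjoin_int \<theta>" "x \<notin> adjoin_int \<theta>"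
  obtains g u k where "lead_coeff u = 1" "0 < degree u" "[:q:] dvd f - g * u"
    "algebraic_int (int_eval \<theta> g / of_int q)" "g ^ k \<in> mod_ideal q u"
proof -
  have q: "q \<noteq> 0" using assms(1) by auto
  define M where "M = {h. algebraic_int (int_eval \<theta> h / of_int q)}"
  have M_add: "g + h \<in> M" if "g \<in> M" "h \<in> M" for g h
    using that by (auto simp: M_def add_divide_distrib intro: algebraic_int_add_mult)
  have M_mult: "g * h \<in> M" if "h \<in> M" for g h
  proof -
    have "int_eval \<theta> (g * h) / of_int q = int_eval \<theta> g * (int_eval \<theta> h / of_int q)" by simp
    then show ?thesis using that algebraic_int_int_eval[OF algebraic_int_root, of g]
      unfolding M_def by (metis algebraic_int_add_mult(2) mem_Collect_eq)
  qed
  have M_dvd: "h \<in> M" if dvd: "[:q:] dvd h" for h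
  proof -
    obtain t where "h = [:q:] * t" using dvd by blast
    then have "int_eval \<theta> h / of_int q = int_eval \<theta> t" using q by simp
    then show ?thesis using algebraic_int_int_eval[OF algebraic_int_root, of t] by (simp add: M_def)
  qed
  obtain h0 where h0: "of_int q * x = int_eval \<theta> h0" using assms(3) by (auto simp: adjoin_int_eq)
  obtain h1 where h1: "degree h1 < degree f" "int_eval \<theta> h1 = int_eval \<theta> h0" by (rule reduce)
  have "int_eval \<theta> h1 / of_int q = x" using h1(2) h0 q by (simp add: field_simps)
  then have "h1 \<in> M" using assms(2) by (simp add: M_def)
  moreover have "\<not> [:q:] dvd h1"
  proof
    assume "[:q:] dvd h1"
    then obtain t where "h1 = [:q:] * t" by blast
    then have "of_int q * x = of_int q * int_eval \<theta> t" using h1 h0 by simp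
    then have "x = int_eval \<theta> t" using q by simp
    then show False using assms(4) by (simp add: adjoin_int_eq)
  qed
  ultimately obtain h where h: "h \<in> M" "\<not> [:q:] dvd h"
    and least: "\<And>h'. h' \<in> M \<Longrightarrow> \<not> [:q:] dvd h' \<Longrightarrow> degree h \<le> degree h'"
    using ex_has_least_nat[of "\<lambda>h. h \<in> M \<and> \<not> [:q:] dvd h" h1 degree] by blast
  have "degree h < degree f" using least[of h1] \<open>h1 \<in> M\<close> \<open>\<not> [:q:] dvd h1\<close> h1 by simp
  obtain g a where g: "lead_coeff g = 1" "degree g \<le> degree h" "[:q:] dvd g - smult a h"
    using not_const_dvd_make_monic[OF assms(1) h(2)] by blast
  have "g \<in> M"
    using M_add[OF M_dvd[OF g(3)] M_mult[OF h(1), of "[:a:]"]] by simp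
  obtain u r where ur: "f = g * u + r" "r = 0 \<or> degree r < degree g"
    using monic_division[OF g(1), of f] by blast
  have "r = f + (- u) * g" using ur(1) by (simp add: algebra_simps)
  moreover have "f \<in> M" using root by (simp add: M_def)
  ultimately have "r \<in> M" using M_add M_mult \<open>g \<in> M\<close> by metis
  then have r: "[:q:] dvd r" using ur(2) least[of r] g(2) by (cases "r = 0") auto
  have deg_r: "degree r < degree f" using ur(2) g(2) \<open>degree h < degree f\<close> degree_pos by auto
  have gu: "g * u = f + (- r)" using ur(1) by simp
  have deg: "degree (g * u) = degree f"
    unfolding gu using deg_r by (intro degree_add_eq_left) simp
  have "lead_coeff (g * u) = 1"
    unfolding deg using deg_r monic by (simp add: gu coeff_eq_0)
  then have u: "lead_coeff u = 1" using g(1) by (simp add: lead_coeff_mult)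
  have "u \<noteq> 0" "g \<noteq> 0" using u g(1) by auto
  then have "0 < degree u" using deg degree_mult_eq[of g u] g(2) \<open>degree h < degree f\<close> by simp
  obtain k where "g ^ k \<in> mod_ideal q f"
    using power_in_mod_ideal[OF q] \<open>g \<in> M\<close> by (auto simp: M_def)
  then obtain s where s: "[:q:] dvd g ^ k - f * s" by (auto simp: mod_ideal_def)
  have "g ^ k = (g ^ k - f * s) + r * s + u * (g * s)" using ur(1) by (simp add: algebra_simps)
  then have "g ^ k \<in> mod_ideal q u"
    using mod_ideal_add mod_ideal_dvdI[OF s] mod_ideal_dvdI[OF dvd_mult2[OF r]] mod_ideal_genI by metis
  moreover have "[:q:] dvd f - g * u" using ur(1) r by simp
  ultimately show thesis using that[of u g k] u \<open>0 < degree u\<close> \<open>g \<in> M\<close> by (simp add: M_def)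
qed

text \<open>With \<open>y\<close> the given integral element, \<open>(\<theta> - a) y = - f(a)/q\<close> is a rational integer \<open>- c\<close>.
  Multiplying an integral equation of \<open>y\<close> by a power of \<open>\<theta> - a\<close> and reading the resulting
  multiple of \<open>f\<close> at \<open>a\<close> shows that \<open>f(a) = q c\<close> divides a power of \<open>c\<close>.\<close>

lemma prime_square_dvd_if_integral:
  assumes "prime q" "1 < degree f" "q dvd poly f a"
    and "algebraic_int (int_eval \<theta> (synthetic_div f a) / of_int q)"
  shows "q\<^sup>2 dvd poly f a"
proof -
  have q: "q \<noteq> 0" using assms(1) by auto
  define y where "y = int_eval \<theta> (synthetic_div f a) / of_int q"
  define b where "b = \<theta> - of_int a"
  obtain c where c: "poly f a = q * c" using assms(3) by blast
  have "int_eval \<theta> ([:- a, 1:] * synthetic_div f a + [:poly f a:]) = 0"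
    using root synthetic_div_eq[of f a] by simp
  then have "b * (of_int q * y) + of_int (q * c) = 0"
    using q by (simp add: y_def b_def c algebra_simps)
  then have "of_int q * (b * y + of_int c) = 0" by (simp add: algebra_simps)
  then have b_y: "b * y = of_int (- c)" using q by (simp add: add_eq_0_iff2)
  obtain P where P: "int_eval y P = 0" "lead_coeff P = 1"
    using assms(4) unfolding y_def algebraic_int_iff_int_eval by blast
  define k where "k = degree P"
  define H where "H = (\<Sum>i<k. smult (coeff P i * (- c) ^ i) ([:- a, 1:] ^ (k - i)))"
  have "int_eval \<theta> ([:(- c) ^ k:] + H) = (\<Sum>i\<le>k. of_int (coeff P i * (- c) ^ i) * b ^ (k - i))"
    using P(2) by (simp add: H_def lessThan_Suc_atMost[symmetric] k_def b_def)
  also have "\<dots> = (\<Sum>i\<le>k. b ^ k * (of_int (coeff P i) * y ^ i))"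
  proof (rule sum.cong)
    fix i assume "i \<in> {..k}"
    then have "b ^ k = b ^ (k - i) * b ^ i"
      by (simp add: power_add[symmetric])
    moreover have "of_int ((- c) ^ i) = b ^ i * y ^ i"
      unfolding power_mult_distrib[symmetric] b_y by simp
    ultimately show "of_int (coeff P i * (- c) ^ i) * b ^ (k - i) = b ^ k * (of_int (coeff P i) * y ^ i)"
      by (simp only: of_int_mult mult_ac)
  qed simp
  also have "\<dots> = b ^ k * int_eval y P"
    unfolding int_eval_altdef[of y] by (simp add: sum_distrib_left k_def)
  finally have "f dvd [:(- c) ^ k:] + H" using P(1) by (simp add: int_eval_eq_0_iff[symmetric])
  then have "poly f a dvd poly ([:(- c) ^ k:] + H) a" by (metis dvd_def poly_mult)
  moreover have "poly H a = 0" by (auto simp: H_def poly_sum intro!: sum.neutral)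
  ultimately have "q * c dvd (- c) ^ k" using c by simp
  then have "q dvd (- c) ^ k" using dvd_mult_left by blast
  then have "q dvd c" using assms(1) prime_dvd_power by (metis dvd_minus_iff)
  then show ?thesis using c by (simp add: power2_eq_square)
qed

lemma square_dvd_value:
  assumes q: "prime q" "1 < degree f" and u: "lead_coeff u = 1" "0 < degree u"
    and gu: "[:q:] dvd f - g * u" "algebraic_int (int_eval \<theta> g / of_int q)"
    and L: "[:e, d:] ^ j \<in> mod_ideal q u" "\<not> q dvd d" "q dvd d * a + e"
  shows "q\<^sup>2 dvd poly f a"
proof -
  have q0: "q \<noteq> 0" using q by auto
  define u' where "u' = synthetic_div u a"
  define c where "c = poly u a"
  have u': "u = [:- a, 1:] * u' + [:c:]" unfolding u'_def c_def by (rule synthetic_div_eq)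
  have "[:q:] dvd [:e, d:] - smult d [:- a, 1:]"
    using L(3) by (simp add: add.commute)
  then have "[:e, d:] - smult d [:- a, 1:] \<in> mod_ideal q u" by (rule mod_ideal_dvdI)
  then have "smult d [:- a, 1:] ^ j \<in> mod_ideal q u" by (rule mod_ideal_power_cong[OF L(1)])
  then have "(- u') ^ j * smult d [:- a, 1:] ^ j \<in> mod_ideal q u" by (rule mod_ideal_mult)
  then have "(- u' * smult d [:- a, 1:]) ^ j \<in> mod_ideal q u" by (simp only: power_mult_distrib)
  moreover have "- u' * smult d [:- a, 1:] - [:d * c:] = u * [:- d:]"
    unfolding u' by (simp add: algebra_simps)
  then have "- u' * smult d [:- a, 1:] - [:d * c:] \<in> mod_ideal q u" by (metis mod_ideal_genI)
  ultimately have "[:d * c:] ^ j \<in> mod_ideal q u" by (rule mod_ideal_power_cong)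
  then have "[:(d * c) ^ j:] \<in> mod_ideal q u" by (simp add: poly_const_pow)
  then have "[:q:] dvd [:(d * c) ^ j:]"
    by (rule mod_ideal_low_degree[OF u(1)]) (use u(2) in simp)
  then have "q dvd (d * c) ^ j" by simp
  then have "q dvd d * c" using q(1) prime_dvd_power by blast
  then have c: "q dvd c" using L(2) q(1) prime_dvd_mult_iff by blast
  obtain r where r: "f - g * u = [:q:] * r" using gu by blast
  have "poly (f - g * u) a = q * poly r a" unfolding r by simp
  then have "poly f a = q * poly r a + poly g a * c" by (simp add: c_def)
  then have fa: "q dvd poly f a" using c by simp
  define G where "G = synthetic_div f a"
  have G: "f = [:- a, 1:] * G + [:poly f a:]" unfolding G_def by (rule synthetic_div_eq)
  have *: "y * (G - g * u') = (f - g * u) + (g * w - v)"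
    if "f = y * G + v" "u = y * u' + w" for y v w
    unfolding that(1) by (simp add: that(2) algebra_simps)
  have "[:- a, 1:] * (G - g * u') = (f - g * u) + (g * [:c:] - [:poly f a:])"
    using G u' by (rule *)
  moreover have "[:q:] dvd (f - g * u) + (g * [:c:] - [:poly f a:])"
    using c fa by (intro dvd_add[OF gu(1)] dvd_diff dvd_mult) simp_all
  ultimately have "[:q:] dvd [:- a, 1:] * (G - g * u')" by (simp only:)
  moreover have "prime_elem [:q:]"
    unfolding prime_elem_const_poly_iff using q(1) by (rule prime_imp_prime_elem)
  moreover have "\<not> [:q:] dvd [:- a, 1:]"
  proof
    assume "[:q:] dvd [:- a, 1:]"
    then have "q dvd coeff [:- a, 1:] 1" unfolding const_poly_dvd_iff by blast
    then show False using q(1) by (simp add: not_prime_unit)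
  qed
  ultimately have "[:q:] dvd G - g * u'" using prime_elem_dvd_mult_iff by blast
  then obtain t where "G - g * u' = [:q:] * t" by blast
  then have "G = [:q:] * t + g * u'" by (simp add: algebra_simps)
  then have "int_eval \<theta> G = of_int q * int_eval \<theta> t + int_eval \<theta> g * int_eval \<theta> u'"
    by simp
  then have "int_eval \<theta> G / of_int q = int_eval \<theta> t + (int_eval \<theta> g / of_int q) * int_eval \<theta> u'"
    using q0 by (simp add: add_divide_distrib)
  also have "algebraic_int \<dots>"
    by (intro algebraic_int_add_mult gu algebraic_int_int_eval algebraic_int_root)
  finally show ?thesis using prime_square_dvd_if_integral[OF q fa] by (simp add: G_def)
qed

lemma not_maximal_if_double_root:
  assumes "prime q" "1 < degree f" "q\<^sup>2 dvd poly f a" "q dvd poly (pderiv f) a"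
  shows "adjoin_int \<theta> \<noteq> ring_of_integers (adjoin_rat \<theta>)"
proof -
  have q: "q \<noteq> 0" using assms(1) by auto
  define G where "G = synthetic_div f a"
  define g where "g = synthetic_div G a"
  define b where "b = poly G a"
  obtain c where c: "poly f a = q\<^sup>2 * c" using assms(3) by blast
  have G: "f = [:- a, 1:] * G + [:poly f a:]" unfolding G_def by (rule synthetic_div_eq)
  have "pderiv f = pderiv ([:- a, 1:] * G + [:poly f a:])" by (rule arg_cong[OF G])
  also have "\<dots> = [:- a, 1:] * pderiv G + G"
    by (simp only: pderiv_add pderiv_mult) (simp add: pderiv_pCons)
  finally have "poly (pderiv f) a = b" by (simp add: b_def)
  then obtain b' where b': "b = q * b'" using assms(4) by auto
  define h where "h = [:- a, 1:] * g"
  have h: "G = h + [:b:]" unfolding h_def b_def g_def by (rule synthetic_div_eq)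
  have fh: "f = [:- a, 1:] * h + [:- a, 1:] * [:b:] + [:q\<^sup>2 * c:]"
    by (subst G) (simp only: h c distrib_left)
  define y where "y = int_eval \<theta> h / of_int q"
  have "f - [:- a, 1:] * [:b:] - [:q\<^sup>2 * c:] = [:- a, 1:] * h"
    by (subst fh) (simp only: diff_diff_eq add.assoc add_diff_cancel_right')
  then have "h * h = g * (f - [:- a, 1:] * [:b:] - [:q\<^sup>2 * c:])"
    by (simp only: h_def mult_ac)
  also have "\<dots> = g * f - [:b:] * h - [:q\<^sup>2 * c:] * g"
    by (simp only: h_def right_diff_distrib mult_ac)
  finally have "int_eval \<theta> (h * h) = int_eval \<theta> (g * f - [:b:] * h - [:q\<^sup>2 * c:] * g)"
    by (rule arg_cong)
  then have hh: "int_eval \<theta> h * int_eval \<theta> h = - of_int b * int_eval \<theta> h - of_int (q\<^sup>2 * c) * int_eval \<theta> g"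
    by (simp add: root)
  define k :: "nat \<Rightarrow> int poly" where "k = (\<lambda>j. if j = 0 then smult (- c) g else [:- b':])"
  have hy: "int_eval \<theta> h = of_int q * y" using q by (simp add: y_def)
  have "(of_int q)\<^sup>2 * y\<^sup>2 = (of_int q)\<^sup>2 * (- of_int b' * y - of_int c * int_eval \<theta> g)"
    using hh unfolding hy b' power2_eq_square by (simp add: algebra_simps)
  then have "y\<^sup>2 = - of_int b' * y - of_int c * int_eval \<theta> g" using q by simp
  then have "y\<^sup>2 = (\<Sum>j<2. int_eval \<theta> (k j) * y ^ j)"
    by (simp add: k_def numeral_2_eq_2)
  then have "algebraic_int y"
    by (rule algebraic_int_tower(1)[OF algebraic_int_root, rotated]) simp
  then have "y \<in> ring_of_integers (adjoin_rat \<theta>)"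
    by (simp add: ring_of_integers_def y_def int_eval_divide_in_adjoin_rat)
  moreover have "y \<notin> adjoin_int \<theta>"
  proof
    assume "y \<in> adjoin_int \<theta>"
    then obtain w where "y = int_eval \<theta> w" by (auto simp: adjoin_int_eq)
    then have "int_eval \<theta> (h - [:q:] * w) = 0" using q by (simp add: y_def field_simps)
    then obtain v where "h - [:q:] * w = f * v" unfolding int_eval_eq_0_iff by blast
    then have "h - f * v = [:q:] * w" by (simp add: algebra_simps)
    then have "[:q:] dvd h - f * v" by (metis dvd_triv_left)
    then have "h \<in> mod_ideal q f" unfolding mod_ideal_def by blast
    moreover have "degree h < degree f"
    proof -
      have "h = G - [:b:]" using h by simp
      then have "degree h \<le> degree G" by (simp add: degree_diff_le)
      then show ?thesis using assms(2) by (simp add: G_def degree_synthetic_div)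
    qed
    ultimately have "[:q:] dvd h" by (rule mod_ideal_low_degree[OF monic])
    then have "[:q:] dvd [:- a, 1:] * h" by (rule dvd_mult)
    then have "q dvd coeff ([:- a, 1:] * h) (degree f)" by (simp only: const_poly_dvd_iff)
    moreover have "[:- a, 1:] * h = f - ([:- a, 1:] * [:b:] + [:q\<^sup>2 * c:])"
      by (subst fh) (simp only: add.assoc add_diff_cancel_right')
    moreover have "coeff ([:- a, 1:] * [:b:] + [:q\<^sup>2 * c:]) (degree f) = 0"
    proof (rule coeff_eq_0)
      have "degree ([:- a, 1:] * [:b:] + [:q\<^sup>2 * c:]) \<le> 1" by simp
      then show "degree ([:- a, 1:] * [:b:] + [:q\<^sup>2 * c:]) < degree f" using assms(2) by linarith
    qed
    ultimately have "q dvd 1" using monic by (metis coeff_diff diff_zero)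
    then show False using assms(1) by (simp add: not_prime_unit)
  qed
  ultimately show ?thesis by blast
qed

end

subsection \<open>The polynomials \<open>X\<^sup>n + p (B X + 1)\<^sup>m\<close>\<close>

lemma prime_square_not_dvd: "prime (q :: int) \<Longrightarrow> \<not> q\<^sup>2 dvd q"
  by (auto simp: power2_eq_square dest: prime_gt_1_int zdvd_imp_le)

lemma eisenstein_irreducible:
  fixes f :: "int poly"
  assumes p: "prime p" and "lead_coeff f = 1" "0 < degree f"
    and low: "\<And>i. i < degree f \<Longrightarrow> p dvd coeff f i" and "\<not> p\<^sup>2 dvd coeff f 0"
  shows "Factorial_Ring.irreducible f"
proof (rule irreducibleI)
  show "f \<noteq> 0" using assms by auto
  show "\<not> is_unit f" using assms(3) by (auto simp: is_unit_poly_iff)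
  fix A C assume f: "f = A * C"
  have lc: "lead_coeff A * lead_coeff C = 1" using assms(2) f by (simp add: lead_coeff_mult)
  have nz: "A \<noteq> 0" "C \<noteq> 0" using f \<open>f \<noteq> 0\<close> by auto
  have *: "is_unit C" if A0: "p dvd coeff A 0" and f: "f = A * C"
    and lc: "lead_coeff A * lead_coeff C = 1" and nz: "A \<noteq> 0" "C \<noteq> 0" for A C
  proof -
    have C0: "\<not> p dvd coeff C 0"
    proof
      assume "p dvd coeff C 0"
      then have "p * p dvd coeff A 0 * coeff C 0" using A0 by (intro mult_dvd_mono)
      then show False using assms(5) f by (simp add: coeff_mult power2_eq_square)
    qed
    have "\<not> p dvd lead_coeff A" using lc p by (metis dvd_mult2 not_prime_unit)
    then obtain i where i: "\<not> p dvd coeff A i" and least: "\<And>j. j < i \<Longrightarrow> p dvd coeff A j"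
      using exists_least_iff[of "\<lambda>i. \<not> p dvd coeff A i"] by blast
    have "coeff f i = (\<Sum>j\<le>i. coeff A j * coeff C (i - j))" by (simp add: f coeff_mult)
    also have "\<dots> = (\<Sum>j<i. coeff A j * coeff C (i - j)) + coeff A i * coeff C 0"
      by (simp add: lessThan_Suc_atMost[symmetric])
    finally have ci: "coeff f i = (\<Sum>j<i. coeff A j * coeff C (i - j)) + coeff A i * coeff C 0" .
    have "p dvd (\<Sum>j<i. coeff A j * coeff C (i - j))" using least by (intro dvd_sum) auto
    moreover have "\<not> p dvd coeff A i * coeff C 0" using i C0 p by (simp add: prime_dvd_mult_iff)
    ultimately have "\<not> p dvd coeff f i" unfolding ci by (simp add: dvd_add_right_iff)
    then have "degree f \<le> i" using low not_less by blast
    also have "i \<le> degree A" using i by (intro le_degree) auto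
    finally have "degree C = 0" using f nz by (simp add: degree_mult_eq)
    then obtain c where "C = [:c:]" by (auto elim: degree_eq_zeroE)
    then show ?thesis using lc by (intro dvdI[of _ _ "[:lead_coeff A:]"]) (simp add: mult.commute one_pCons)
  qed
  have "p dvd coeff A 0 * coeff C 0" using low[OF assms(3)] by (simp add: f coeff_mult)
  then have "p dvd coeff A 0 \<or> p dvd coeff C 0" using p by (simp add: prime_dvd_mult_iff)
  then show "is_unit A \<or> is_unit C" using *[of A C] *[of C A] f lc nz by (auto simp: mult.commute)
qed

definition trinomial_power :: "nat \<Rightarrow> nat \<Rightarrow> nat \<Rightarrow> nat \<Rightarrow> int poly" where
  "trinomial_power p n m B = [:0, 1:] ^ n + of_nat p * [:1, int B:] ^ m"

lemma X_power_eq_monom: "[:0, 1:] ^ n = monom (1 :: 'a :: comm_semiring_1) n"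
  by (simp add: monom_altdef)

lemma trinomial_power_monic:
  assumes "m < n"
  shows "degree (trinomial_power p n m B) = n" "lead_coeff (trinomial_power p n m B) = 1"
proof -
  have 1: "degree ([:0, 1:] ^ n :: int poly) = n" "coeff ([:0, 1:] ^ n :: int poly) n = 1"
    by (simp_all add: X_power_eq_monom degree_monom_eq)
  have "degree (of_nat p * [:1, int B:] ^ m) \<le> degree (of_nat p :: int poly) + degree ([:1, int B:] ^ m)"
    by (rule degree_mult_le)
  also have "\<dots> \<le> m" using degree_power_le[of "[:1, int B:]" m] by (auto split: if_splits)
  finally have 2: "degree (of_nat p * [:1, int B:] ^ m) < n" using assms by simp
  then show "degree (trinomial_power p n m B) = n"
    unfolding trinomial_power_def using 1 by (subst degree_add_eq_left) auto
  then show "lead_coeff (trinomial_power p n m B) = 1"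
    using 1 2 by (simp add: trinomial_power_def coeff_eq_0)
qed

lemma trinomial_power_irreducible:
  assumes "prime p" "m < n"
  shows "Factorial_Ring.irreducible (trinomial_power p n m B)"
proof (rule eisenstein_irreducible)
  show "prime (int p)" using assms by simp
  note d = trinomial_power_monic[OF assms(2), of p B]
  show "lead_coeff (trinomial_power p n m B) = 1" by (rule d)
  show "0 < degree (trinomial_power p n m B)" using d assms by simp
  fix i assume "i < degree (trinomial_power p n m B)"
  then show "int p dvd coeff (trinomial_power p n m B) i"
    using d(1) by (simp add: trinomial_power_def of_nat_poly X_power_eq_monom)
next
  have "coeff (trinomial_power p n m B) 0 = int p"
    using assms by (simp add: trinomial_power_def of_nat_poly flip: poly_0_coeff_0)
  moreover have "\<not> (int p)\<^sup>2 dvd int p"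
    using assms(1) by (simp add: prime_square_not_dvd)
  ultimately show "\<not> (int p)\<^sup>2 dvd coeff (trinomial_power p n m B) 0" by simp
qed

text \<open>The linear factor on the right carries every multiple root modulo a prime other than \<open>p\<close>.\<close>

lemma trinomial_power_pderiv:
  assumes "0 < m" "m < n"
  shows "[:0, 1:] * pderiv (trinomial_power p n m B) - of_nat n * trinomial_power p n m B =
    - ([:int p:] * [:1, int B:] ^ (m - 1) * [:int n, int (n - m) * int B:])"
proof -
  obtain m' where m: "m = Suc m'" using assms by (cases m) auto
  obtain n' where n: "n = Suc n'" using assms by (cases n) auto
  define x y c s k l :: "int poly" where "x = [:0, 1:]" and "y = [:1, int B:]" and "c = [:int B:]"
    and "s = [:int p:]" and "k = of_nat n" and "l = of_nat m"
  have y: "y = 1 + c * x" by (simp add: x_def y_def c_def one_pCons)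
  have L: "[:int n, int (n - m) * int B:] = k + (k - l) * c * x"
    using assms by (simp add: x_def c_def k_def l_def of_nat_poly of_nat_diff)
  have T: "trinomial_power p n m B = x ^ n + s * y ^ m"
    by (simp add: trinomial_power_def x_def y_def s_def of_nat_poly)
  have "pderiv (x ^ n) = k * x ^ n'"
    unfolding n pderiv_power_Suc k_def x_def by (simp add: pderiv_pCons of_nat_poly)
  moreover have "pderiv (y ^ m) = l * y ^ m' * c"
    unfolding m pderiv_power_Suc l_def y_def c_def by (simp add: pderiv_pCons of_nat_poly)
  moreover have "pderiv (s * y ^ m) = s * pderiv (y ^ m)" by (simp add: s_def pderiv_smult)
  ultimately have D: "pderiv (trinomial_power p n m B) = k * x ^ n' + s * (l * y ^ m' * c)"
    unfolding T by (simp only: pderiv_add)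
  have "x * (k * x ^ n' + s * (l * w * c)) - k * (x * x ^ n' + s * (y * w)) =
    - (s * w * (k + (k - l) * c * x))" for w
    by (simp add: y algebra_simps)
  from this[of "y ^ m'"] show ?thesis
    unfolding D unfolding L T x_def[symmetric] y_def[symmetric] s_def[symmetric] k_def[symmetric]
    by (simp only: m n power_Suc diff_Suc_1)
qed

lemma trinomial_power_value_cong:
  assumes "m < n" "k dvd int (n - m) * int B * a + int n"
  shows "[(int (n - m) * int B) ^ n * poly (trinomial_power p n m B) a =
    (-1) ^ n * (int n ^ n + (-1) ^ (n + m) * int B ^ n * int (n - m) ^ (n - m) * int m ^ m * int p)] (mod k)"
proof -
  define d where "d = int (n - m)"
  have da: "[d * int B * a = - int n] (mod k)"
    using assms(2) by (simp add: cong_iff_dvd_diff d_def)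
  have "d * (1 + int B * a) = d * int B * a + d" by (simp add: algebra_simps)
  moreover have "[d * int B * a + d = - int n + d] (mod k)" by (intro cong_add da cong_refl)
  moreover have "- int n + d = - int m" using assms by (simp add: d_def of_nat_diff)
  ultimately have dm: "[d * (1 + int B * a) = - int m] (mod k)" by simp
  have "d ^ n = d ^ (n - m) * d ^ m" using assms by (simp flip: power_add)
  then have dB: "(d * int B) ^ n = int B ^ n * d ^ (n - m) * d ^ m"
    by (simp only: power_mult_distrib mult_ac)
  have "poly (trinomial_power p n m B) a = a ^ n + int p * (1 + int B * a) ^ m"
    by (simp add: trinomial_power_def mult.commute)
  then have "(d * int B) ^ n * poly (trinomial_power p n m B) a =
    (d * int B) ^ n * a ^ n + (d * int B) ^ n * (int p * (1 + int B * a) ^ m)"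
    by (simp only: distrib_left)
  moreover have "(d * int B) ^ n * a ^ n = (d * int B * a) ^ n"
    by (simp only: power_mult_distrib)
  moreover have "(d * int B) ^ n * (int p * (1 + int B * a) ^ m) =
    int B ^ n * d ^ (n - m) * (d * (1 + int B * a)) ^ m * int p"
    unfolding dB power_mult_distrib[of d "1 + int B * a"] by (simp only: mult_ac)
  moreover have "[(d * int B * a) ^ n + int B ^ n * d ^ (n - m) * (d * (1 + int B * a)) ^ m * int p =
    (- int n) ^ n + int B ^ n * d ^ (n - m) * (- int m) ^ m * int p] (mod k)"
    by (intro cong_add cong_mult cong_pow cong_refl da dm)
  moreover have "(- int n) ^ n + int B ^ n * d ^ (n - m) * (- int m) ^ m * int p =
    (-1) ^ n * (int n ^ n + (-1) ^ (n + m) * int B ^ n * d ^ (n - m) * int m ^ m * int p)"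
  proof -
    have "(-1 :: int) ^ n * (-1) ^ (n + m) = (-1) ^ m"
      by (simp add: power_add flip: power_mult_distrib mult.assoc)
    then show ?thesis
      by (simp add: power_minus[of "int n"] power_minus[of "int m"] distrib_left mult.assoc[symmetric])
  qed
  ultimately show ?thesis unfolding d_def by simp
qed

lemma trinomial_power_cancel:
  assumes "0 < m" and f: "trinomial_power p n m B \<in> mod_ideal q u"
    and w: "[:1, int B:] ^ j * w \<in> mod_ideal q u"
  shows "w \<in> mod_ideal q u"
  using w
proof (induction j)
  case 0
  then show ?case by simp
next
  case (Suc j)
  define y w' :: "int poly" where "y = [:1, int B:]" and "w' = y ^ j * w"
  obtain m' where m: "m = Suc m'" using assms(1) by (cases m) auto
  have yw: "y * w' \<in> mod_ideal q u" using Suc.prems by (simp only: y_def w'_def power_Suc mult.assoc)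
  have "[:0, 1:] ^ n * w' = w' * trinomial_power p n m B - (of_nat p * y ^ m') * (y * w')"
    by (simp add: trinomial_power_def m y_def algebra_simps)
  also have "\<dots> \<in> mod_ideal q u" by (intro mod_ideal_diff mod_ideal_mult f yw)
  finally have "[:int B:] ^ n * ([:0, 1:] ^ n * w') \<in> mod_ideal q u" by (rule mod_ideal_mult)
  moreover have "[:int B:] * [:0, 1:] = y - 1" by (simp add: y_def one_pCons)
  then have "[:int B:] ^ n * [:0, 1:] ^ n = (y - 1) ^ n" by (metis power_mult_distrib)
  ultimately have 1: "(y - 1) ^ n * w' \<in> mod_ideal q u" by (simp only: mult.assoc[symmetric])
  have "(y - 1) - (- 1) dvd (y - 1) ^ n - (- 1) ^ n" by (simp only: power_diff_sumr2 dvd_triv_left)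
  then obtain t where t: "(y - 1) ^ n - (- 1) ^ n = y * t" by auto
  have "(- 1) ^ n * w' = (y - 1) ^ n * w' - t * (y * w')"
    using t by (simp add: algebra_simps)
  also have "\<dots> \<in> mod_ideal q u" by (intro mod_ideal_diff mod_ideal_mult 1 yw)
  finally have "(- 1) ^ n * ((- 1) ^ n * w') \<in> mod_ideal q u" by (rule mod_ideal_mult)
  then have "w' \<in> mod_ideal q u" by (simp flip: mult.assoc power_mult_distrib)
  then show ?case using Suc.IH by (simp add: w'_def y_def)
qed

lemma trinomial_power_linear_in_mod_ideal:
  assumes "prime q" "\<not> q dvd int p" "0 < m" "m < n"
    and gu: "[:q:] dvd trinomial_power p n m B - g * u" and gk: "g ^ k \<in> mod_ideal q u"
  shows "[:int n, int (n - m) * int B:] ^ k \<in> mod_ideal q u"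
proof -
  define f where "f = trinomial_power p n m B"
  define T where "T = [:int p:] * [:1, int B:] ^ (m - 1) * [:int n, int (n - m) * int B:]"
  obtain r where r: "f - g * u = [:q:] * r" using gu by (auto simp: f_def)
  have "f = (f - g * u) + u * g" by simp
  then have f: "f \<in> mod_ideal q u"
    using gu unfolding f_def by (metis mod_ideal_add mod_ideal_dvdI mod_ideal_genI)
  have "f = g * u + [:q:] * r" using r by (simp add: algebra_simps)
  then have D: "pderiv f = pderiv g * u + g * pderiv u + [:q:] * pderiv r"
    by (simp add: pderiv_add pderiv_mult pderiv_smult)
  have T: "T = of_nat n * f - [:0, 1:] * pderiv f"
    using trinomial_power_pderiv[OF assms(3,4), of p B] unfolding T_def f_def
    by (metis minus_diff_eq minus_minus)
  have "(- (x * pderiv u)) * g - (of_nat n * f - x * pderiv f) =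
    u * (x * pderiv g) + [:q:] * (x * pderiv r) - of_nat n * f" for x
    unfolding D by (simp add: algebra_simps)
  then have "(- ([:0, 1:] * pderiv u)) * g - T =
    u * ([:0, 1:] * pderiv g) + [:q:] * ([:0, 1:] * pderiv r) - of_nat n * f"
    unfolding T .
  also have "\<dots> \<in> mod_ideal q u"
    by (intro mod_ideal_diff mod_ideal_add mod_ideal_mult[OF f] mod_ideal_genI mod_ideal_dvdI dvd_triv_left)
  finally have "(- ([:0, 1:] * pderiv u)) * g - T \<in> mod_ideal q u" .
  moreover have "((- ([:0, 1:] * pderiv u)) * g) ^ k \<in> mod_ideal q u"
    unfolding power_mult_distrib by (rule mod_ideal_mult[OF gk])
  ultimately have "T ^ k \<in> mod_ideal q u" by (rule mod_ideal_power_cong[rotated])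
  moreover have "T ^ k = [:int p ^ k:] * (([:1, int B:] ^ ((m - 1) * k)) * [:int n, int (n - m) * int B:] ^ k)"
    unfolding T_def power_mult_distrib power_mult by (simp only: poly_const_pow mult.assoc)
  moreover have "\<not> q dvd int p ^ k" using assms(1,2) prime_dvd_power by blast
  ultimately have "[:1, int B:] ^ ((m - 1) * k) * [:int n, int (n - m) * int B:] ^ k \<in> mod_ideal q u"
    using mod_ideal_cancel_const[OF assms(1)] by metis
  then show ?thesis by (rule trinomial_power_cancel[OF assms(3) f[unfolded f_def]])
qed

lemma linear_root_mod_square:
  fixes q d e :: int
  assumes "prime q" "\<not> q dvd d"
  obtains a where "q\<^sup>2 dvd d * a + e"
proof -
  have "coprime d q" using assms prime_imp_coprime coprime_commute by blast
  then have "coprime d (q\<^sup>2)" by simp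
  then obtain x where "[d * x = 1] (mod q\<^sup>2)" using cong_solve_coprime_int by blast
  then have "[(d * x) * (- e) = 1 * (- e)] (mod q\<^sup>2)" by (intro cong_mult cong_refl)
  then have "q\<^sup>2 dvd d * (x * - e) + e" by (simp add: cong_iff_dvd_diff mult.assoc)
  then show thesis by (rule that)
qed

theorem corollary4p2:
  fixes p n m B :: nat
  assumes "Factorial_Ring.prime p"
    and "n > 2" and "1 \<le> m" and "m \<le> n - 1" and "B > 0"
    and "gcd n (m * B) = 1"
  shows "monogenic ([:0, 1:] ^ n + of_nat p * [:1, int B:] ^ m) \<longleftrightarrow>
    squarefree (int n ^ n + (-1) ^ (n + m) * int B ^ n * int (n - m) ^ (n - m) * int m ^ m * int p)"
proof -
  note p = assms(1) and n = assms(2)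
  have m: "0 < m" "m < n" using assms by auto
  have cop: "coprime n (m * B)" using assms(6) by (simp add: coprime_iff_gcd_eq_1)
  define D where "D = int n ^ n + (-1) ^ (n + m) * int B ^ n * int (n - m) ^ (n - m) * int m ^ m * int p"
  define f where "f = trinomial_power p n m B"
  define d where "d = int (n - m) * int B"
  note f = trinomial_power_monic[OF m(2), of p B, folded f_def]
  have irred: "Factorial_Ring.irreducible f"
    unfolding f_def by (rule trinomial_power_irreducible[OF p m(2)])
  have "coprime n (n - m)"
    using cop m(2) by (metis coprime_diff_one_left_nat coprime_mult_right_iff coprime_iff_gcd_eq_1 gcd.commute gcd_diff2_nat less_imp_le_nat)
  then have "coprime n ((n - m) * B)" using cop by simp
  then have "coprime (int n) (int ((n - m) * B))" by (simp only: coprime_int_iff)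
  then have cop_d: "coprime (int n) d" by (simp add: d_def)
  have value_cong: "[d ^ n * poly f a = (-1) ^ n * D] (mod q\<^sup>2)" if "q\<^sup>2 dvd d * a + int n" for a q
    using trinomial_power_value_cong[OF m(2), of "q\<^sup>2" B a p] that unfolding f_def d_def D_def by simp
  have "monogenic f \<longleftrightarrow> squarefree D"
  proof
    assume sf: "squarefree D"
    have "adjoin_int \<theta> = ring_of_integers (adjoin_rat \<theta>)" if "int_eval \<theta> f = 0" for \<theta>
    proof -
      interpret monic_irreducible_root f \<theta>
        using f irred that by unfold_locales simp_all
      have "x \<in> adjoin_int \<theta>"
        if x: "prime q" "algebraic_int x" "of_int q * x \<in> adjoin_int \<theta>" for q x
      proof (rule ccontr)
        assume "x \<notin> adjoin_int \<theta>"
        then obtain g u k where u: "lead_coeff u = 1" "0 < degree u"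
          and gu: "[:q:] dvd f - g * u" "algebraic_int (int_eval \<theta> g / of_int q)"
          and gk: "g ^ k \<in> mod_ideal q u"
          by (rule non_maximal_factorisation[OF x])
        have deg: "1 < degree f" using f n by simp
        note square = square_dvd_value[OF x(1) deg u gu]
        show False
        proof (cases "q dvd int p")
          case True
          then have q: "q = int p" using x(1) p by (metis prime_nat_int_transfer primes_dvd_imp_eq)
          have "[:0, 1:] ^ n = (f - g * u) + u * g - [:q:] * [:1, int B:] ^ m"
            by (simp add: f_def trinomial_power_def q of_nat_poly algebra_simps)
          also have "\<dots> \<in> mod_ideal q u"
            by (intro mod_ideal_diff mod_ideal_add mod_ideal_genI mod_ideal_dvdI gu(1) dvd_triv_left)
          finally have "q\<^sup>2 dvd poly f 0"
            using x(1) by (intro square) (auto simp: not_prime_unit)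
          moreover have "poly f 0 = int p" using n by (simp add: f_def trinomial_power_def zero_power)
          ultimately show False using x(1) by (simp add: q prime_square_not_dvd)
        next
          case False
          have L: "[:int n, d:] ^ k \<in> mod_ideal q u"
            using trinomial_power_linear_in_mod_ideal[OF x(1) False m gu(1)[unfolded f_def] gk]
            by (simp add: d_def)
          have "\<not> q dvd d"
          proof
            assume "q dvd d"
            then have "[:q:] dvd [:int n, d:] - [:int n:]" by (simp add: const_poly_dvd_iff coeff_pCons split: nat.split)
            then have "[:int n:] ^ k \<in> mod_ideal q u"
              by (intro mod_ideal_power_cong[OF L] mod_ideal_dvdI)
            then have "[:int n ^ k:] \<in> mod_ideal q u" by (simp add: poly_const_pow)
            then have "[:q:] dvd [:int n ^ k:]"
              by (rule mod_ideal_low_degree[OF u(1)]) (use u(2) in simp)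
            then have "q dvd int n" using x(1) prime_dvd_power by simp
            then show False using \<open>q dvd d\<close> cop_d x(1) coprime_common_divisor not_prime_unit by blast
          qed
          then obtain a where a: "q\<^sup>2 dvd d * a + int n" by (rule linear_root_mod_square[OF x(1)])
          then have "q dvd d * a + int n" by (metis dvd_mult_left power2_eq_square)
          then have "q\<^sup>2 dvd poly f a" by (rule square[OF L \<open>\<not> q dvd d\<close>])
          then have "q\<^sup>2 dvd d ^ n * poly f a" by simp
          then have "q\<^sup>2 dvd (-1) ^ n * D"
            using value_cong[OF a] by (metis cong_0_iff cong_sym cong_trans)
          then have "q\<^sup>2 dvd D" by (cases "even n") simp_all
          then show False using sf x(1) by (auto simp: squarefree_def not_prime_unit)
        qed
      qed
      then show ?thesis using adjoin_int_subset ring_of_integers_subset by blast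
    qed
    then show "monogenic f"
      unfolding monogenic_def using f irred by (simp add: int_eval_def)
  next
    assume mon: "monogenic f"
    show "squarefree D"
    proof (rule ccontr)
      assume "\<not> squarefree D"
      then obtain z where z: "z\<^sup>2 dvd D" "\<not> is_unit z" by (auto simp: squarefree_def)
      obtain q where q: "prime q" "q dvd z"
      proof (cases "z = 0")
        case True
        then show thesis using that[of 2] by simp
      next
        case False
        then show thesis using that z(2) prime_divisor_exists by blast
      qed
      have qD: "q\<^sup>2 dvd D" using q(2) z(1) dvd_power_same dvd_trans by blast
      obtain \<theta> where root: "int_eval \<theta> f = 0"
      proof -
        have "degree (map_poly of_int f :: complex poly) \<noteq> 0" using f n by simp
        then have "\<not> constant (poly (map_poly of_int f :: complex poly))" by (simp add: constant_degree)
        then show thesis using that fundamental_theorem_of_algebra unfolding int_eval_def by blast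
      qed
      interpret monic_irreducible_root f \<theta>
        using f irred root by unfold_locales simp_all
      have qn: "\<not> q dvd int n"
      proof
        assume qn: "q dvd int n"
        then have not_dvd: "\<not> q dvd c" if "coprime (int n) c" for c
          using that q(1) coprime_common_divisor not_prime_unit by blast
        have nd: "\<not> q dvd int B" "\<not> q dvd int m" "\<not> q dvd int (n - m)"
          using cop \<open>coprime n (n - m)\<close> by (auto intro!: not_dvd)
        define t where "t = (-1) ^ (n + m) * int B ^ n * int (n - m) ^ (n - m) * int m ^ m"
        have "q\<^sup>2 dvd int n ^ n" using qn n by (intro dvd_trans[OF dvd_power_same[OF qn, of 2] le_imp_power_dvd]) simp
        then have "q\<^sup>2 dvd t * int p" using qD by (simp add: D_def t_def dvd_add_right_iff)
        moreover have "\<not> q dvd t"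
          using nd q(1) by (auto simp: t_def prime_dvd_mult_iff minus_one_power_iff not_prime_unit dest: prime_dvd_power)
        then have "coprime (q\<^sup>2) t" using q(1) by (simp add: prime_imp_coprime)
        ultimately have "q\<^sup>2 dvd int p" by (simp add: coprime_dvd_mult_right_iff)
        moreover from this have "q dvd int p" by (metis dvd_mult_left power2_eq_square)
        then have "q = int p" using q(1) p by (metis prime_nat_int_transfer primes_dvd_imp_eq)
        ultimately show False using q(1) prime_square_not_dvd by blast
      qed
      have nd: "\<not> q dvd d"
      proof
        assume "q dvd d"
        then have "q dvd int (n - m) \<or> q dvd int B" using q(1) by (simp add: d_def prime_dvd_mult_iff)
        then have "q dvd int (n - m) ^ (n - m) \<or> q dvd int B ^ n"
          using n m by (auto intro: dvd_power_le[of q _ 1, simplified])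
        then have "q dvd (-1) ^ (n + m) * int B ^ n * int (n - m) ^ (n - m) * int m ^ m * int p"
          by (auto intro: dvd_mult dvd_mult2)
        moreover have "q dvd D" using qD by (metis dvd_mult_left power2_eq_square)
        ultimately have "q dvd int n ^ n" unfolding D_def using dvd_add_left_iff by blast
        then show False using qn q(1) prime_dvd_power by blast
      qed
      obtain a where a: "q\<^sup>2 dvd d * a + int n" by (rule linear_root_mod_square[OF q(1) nd])
      have "q\<^sup>2 dvd (-1) ^ n * D" using qD by simp
      then have "q\<^sup>2 dvd d ^ n * poly f a"
        using value_cong[OF a] by (metis cong_0_iff cong_trans)
      moreover have "coprime (q\<^sup>2) (d ^ n)" using q(1) nd by (simp add: prime_imp_coprime)
      ultimately have fa: "q\<^sup>2 dvd poly f a" by (simp add: coprime_dvd_mult_right_iff)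
      have qa: "q dvd d * a + int n" using a by (metis dvd_mult_left power2_eq_square)
      have "poly ([:0, 1:] * pderiv f - of_nat n * f) a =
        poly (- ([:int p:] * [:1, int B:] ^ (m - 1) * [:int n, d:])) a"
        unfolding f_def d_def by (simp only: trinomial_power_pderiv[OF m])
      then have "a * poly (pderiv f) a =
        int n * poly f a - int p * (1 + a * int B) ^ (m - 1) * (d * a + int n)"
        by (simp add: of_nat_poly algebra_simps)
      moreover have "q dvd poly f a" using fa by (metis dvd_mult_left power2_eq_square)
      ultimately have "q dvd a * poly (pderiv f) a" using qa by simp
      moreover have "\<not> q dvd a"
        using qa qn by (metis dvd_add_right_iff dvd_mult)
      ultimately have "q dvd poly (pderiv f) a" using q(1) by (simp add: prime_dvd_mult_iff)
      moreover have "1 < degree f" using f n by simp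
      ultimately have "adjoin_int \<theta> \<noteq> ring_of_integers (adjoin_rat \<theta>)"
        using not_maximal_if_double_root[OF q(1) _ fa] by blast
      then show False
        using mon root unfolding monogenic_def int_eval_def by blast
    qed
  qed
  then show ?thesis unfolding f_def trinomial_power_def D_def .
qed

end
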